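(* Let $D$ be a digraph whose underlying undirected graph $U(D)$ is $6$-choosable. Then $D$ is majority $3$-choosable. In particular, any digraph with a $5$-degenerate underlying graph is majority $3$-choosable.
   Context: Digraphs are finite, loopless, have no parallel edges, but may have anti-parallel pairs of edges (digons). $N^+(v)$ denotes the set of out-neighbors of $v$. The underlying graph $U(D)$ is the simple undirected graph on $V(D)$ in which $x\ne y$ are adjacent iff $(x,y)\in E(D)$ or $(y,x)\in E(D)$. An undirected graph is $k$-choosable if for every assignment of lists of at least $k$ colors to its vertices there is a proper coloring choosing each vertex's color from its list. A graph is $5$-degenerate if each of its nonempty subgraphs has a vertex of degree at most $5$. A majority coloring of $D$ is a vertex-coloring $c$ such that for every $v\in V(D)$, at most half of the out-neighbors $w\in N^+(v)$ satisfy $c(w)=c(v)$. $D$ is majority $k$-choosable if for every assignment of lists $L(v)$ of colors with $|L(v)|\ge k$ to the vertices $v\in V(D)$, there is a majority coloring $c$ of $D$ with $c(v)\in L(v)$ for all $v\in V(D)$. *)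

theory Defs
  imports "Graph_Theory.Digraph_Component"
begin

text \<open>
  An undirected simple graph is represented, as in \<^theory>\<open>Graph_Theory.Digraph\<close>, by the
  symmetric digraph (locale \<^locale>\<open>graph\<close>) containing each edge in both directions.
  Hence the degree of a vertex is its \<^const>\<open>out_degree\<close>.
\<close>

definition underlying_graph :: "('a, 'b) pre_digraph \<Rightarrow> ('a, 'a \<times> 'a) pre_digraph" where
  "underlying_graph D = with_proj (mk_symmetric D)"

lemma underlying_graph_verts [simp]: "verts (underlying_graph D) = verts D"
  by (simp add: underlying_graph_def)

lemma underlying_graph_adj:
  "u \<rightarrow>\<^bsub>underlying_graph D\<^esub> v \<longleftrightarrow> u \<rightarrow>\<^bsub>D\<^esub> v \<or> v \<rightarrow>\<^bsub>D\<^esub> u"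
  by (auto simp: underlying_graph_def parcs_mk_symmetric arcs_ends_conv)

lemma graph_underlying_graph:
  assumes "digraph D"
  shows "graph (underlying_graph D)"
proof -
  interpret digraph D by fact
  interpret S: pair_digraph "mk_symmetric D" ..
  have "pair_graph (mk_symmetric D)"
    by unfold_locales (rule symmetric_mk_symmetric)
  then show ?thesis
    unfolding underlying_graph_def by (rule pair_graph.pair_graphD_graph)
qed

definition out_neighbors :: "('a, 'b) pre_digraph \<Rightarrow> 'a \<Rightarrow> 'a set" where
  "out_neighbors D v = {w. v \<rightarrow>\<^bsub>D\<^esub> w}"

text \<open>
  The disjunct \<^term>\<open>infinite (L v)\<close> is needed because \<^const>\<open>card\<close> is 0 on infinite sets.
\<close>

definition list_assignment :: "nat \<Rightarrow> ('a, 'b) pre_digraph \<Rightarrow> ('a \<Rightarrow> 'c set) \<Rightarrow> bool" where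
  "list_assignment k G L \<longleftrightarrow> (\<forall>v \<in> verts G. infinite (L v) \<or> k \<le> card (L v))"

definition list_coloring :: "('a, 'b) pre_digraph \<Rightarrow> ('a \<Rightarrow> 'c set) \<Rightarrow> ('a \<Rightarrow> 'c) \<Rightarrow> bool" where
  "list_coloring G L c \<longleftrightarrow> (\<forall>v \<in> verts G. c v \<in> L v)"

definition proper_coloring :: "('a, 'b) pre_digraph \<Rightarrow> ('a \<Rightarrow> 'c) \<Rightarrow> bool" where
  "proper_coloring G c \<longleftrightarrow> (\<forall>u v. u \<rightarrow>\<^bsub>G\<^esub> v \<longrightarrow> c u \<noteq> c v)"

definition majority_coloring :: "('a, 'b) pre_digraph \<Rightarrow> ('a \<Rightarrow> 'c) \<Rightarrow> bool" where
  "majority_coloring D c \<longleftrightarrow>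
    (\<forall>v \<in> verts D. 2 * card {w \<in> out_neighbors D v. c w = c v} \<le> card (out_neighbors D v))"

text \<open>
  The type of colors is a parameter, since a definition cannot quantify over types.
  Choosability is a vacuous condition when \<^typ>\<open>'c\<close> has fewer than \<^term>\<open>k\<close> elements;
  as a hypothesis on a finite graph it should be used with an infinite type such as \<^typ>\<open>nat\<close>,
  in which the colors of any choice of finite sublists can be renamed.
\<close>

definition choosable :: "'c itself \<Rightarrow> nat \<Rightarrow> ('a, 'b) pre_digraph \<Rightarrow> bool" where
  "choosable _ k G \<longleftrightarrow>
    (\<forall>L :: 'a \<Rightarrow> 'c set. list_assignment k G L \<longrightarrow>
      (\<exists>c. list_coloring G L c \<and> proper_coloring G c))"

definition majority_choosable :: "'c itself \<Rightarrow> nat \<Rightarrow> ('a, 'b) pre_digraph \<Rightarrow> bool" where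
  "majority_choosable _ k D \<longleftrightarrow>
    (\<forall>L :: 'a \<Rightarrow> 'c set. list_assignment k D L \<longrightarrow>
      (\<exists>c. list_coloring D L c \<and> majority_coloring D c))"

text \<open>
  A \<^const>\<open>subgraph\<close> in the library's sense need not contain both directions of an edge,
  so the undirected subgraphs are those that are again a \<^const>\<open>graph\<close>.
\<close>

definition degenerate :: "nat \<Rightarrow> ('a, 'b) pre_digraph \<Rightarrow> bool" where
  "degenerate d G \<longleftrightarrow>
    (\<forall>H. subgraph H G \<and> graph H \<and> verts H \<noteq> {} \<longrightarrow> (\<exists>v \<in> verts H. out_degree H v \<le> d))"

end

theory Submission
  imports Defs
begin

text \<open>
  Among three colors there are six ordered pairs of distinct colors, so 6-choosability of the
  underlying graph gives every vertex \<open>v\<close> a pair \<open>(a v, b v)\<close> of distinct colors from its list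
  such that adjacent vertices have different pairs. Start by giving each \<open>v\<close> the color \<open>a v\<close>. As
  long as some vertex \<open>v\<close> that still has its first color sees that color on more than half of its
  out-neighbors, move \<open>v\<close> to \<open>b v\<close>. Every vertex moves at most once, and in the end no unmoved
  vertex violates the majority condition.

  The point is that a moved vertex \<open>v\<close> never violates it either. When \<open>v\<close> moves, more than half of
  its out-neighbors \<open>w\<close> have color \<open>a v\<close>, and none of these can have the color \<open>b v\<close> later on.
  Indeed, such a \<open>w\<close> can only change its color if it has not moved yet, that is, if
  \<open>a w = a v\<close>; but then \<open>b w \<noteq> b v\<close>, since adjacent vertices have different pairs.

  The set of moved vertices is obtained below as a fixed point of a monotone operator
  (\<open>majority_coloring_from_pairs\<close>), which replaces the bookkeeping of successive moves. The rest
  is about choosability: if it holds for colors that are natural numbers, it holds for pairs of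
  colors of any type (\<open>choosable_any_colors\<close>), and a \<open>d\<close>-degenerate graph is
  \<open>(d + 1)\<close>-choosable by greedy coloring (\<open>degenerate_choosable\<close>).
\<close>

lemma ex_finite_subset_card:
  assumes "infinite A \<or> k \<le> card A"
  obtains T where "T \<subseteq> A" "finite T" "card T = k"
  using assms infinite_arbitrarily_large[of A k] obtain_subset_with_card_n[of k A] by metis

lemma (in fin_digraph) finite_out_neighbors: "finite (out_neighbors G v)"
proof (rule finite_subset)
  show "out_neighbors G v \<subseteq> verts G"
    by (auto simp: out_neighbors_def)
qed simp

text \<open>
  An out-neighbor \<open>w\<close> of \<open>v\<close> counts against the first color of \<open>v\<close> if it starts with that color or
  has moved to it. Counting the former even after they have moved away makes the condition
  monotone in the set of moved vertices, and it is harmless: they move to a color other than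
  \<open>b v\<close>.
\<close>

lemma majority_coloring_from_pairs:
  fixes D :: "('a, 'b) pre_digraph" and a b :: "'a \<Rightarrow> 'c"
  assumes "fin_digraph D"
    and distinct: "\<And>v. v \<in> verts D \<Longrightarrow> a v \<noteq> b v"
    and proper: "proper_coloring D (\<lambda>v. (a v, b v))"
  shows "\<exists>c. majority_coloring D c \<and> (\<forall>v. c v \<in> {a v, b v})"
proof -
  interpret fin_digraph D by fact
  define S where "S F v = {w \<in> out_neighbors D v. a w = a v \<or> w \<in> F \<and> b w = a v}" for F v
  define \<Phi> where "\<Phi> F = {v. card (out_neighbors D v) < 2 * card (S F v)}" for F
  have S_sub: "S F v \<subseteq> out_neighbors D v" for F v
    by (auto simp: S_def)
  have fin_S: "finite (S F v)" for F v
    using S_sub finite_out_neighbors by (rule finite_subset)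
  have "mono \<Phi>"
  proof (rule monoI)
    fix F F' :: "'a set"
    assume "F \<subseteq> F'"
    then have "card (S F v) \<le> card (S F' v)" for v
      by (intro card_mono[OF fin_S]) (auto simp: S_def)
    then show "\<Phi> F \<subseteq> \<Phi> F'"
      unfolding \<Phi>_def by (force intro: less_le_trans)
  qed
  define F where "F = lfp \<Phi>"
  have "F = \<Phi> F"
    unfolding F_def using \<open>mono \<Phi>\<close> by (rule lfp_unfold)
  then have F_iff: "v \<in> F \<longleftrightarrow> card (out_neighbors D v) < 2 * card (S F v)" for v
    by (auto simp: \<Phi>_def)
  define c where "c v = (if v \<in> F then b v else a v)" for v
  have "majority_coloring D c"
    unfolding majority_coloring_def
  proof
    fix v
    assume v: "v \<in> verts D"
    let ?M = "{w \<in> out_neighbors D v. c w = c v}"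
    show "2 * card ?M \<le> card (out_neighbors D v)"
    proof (cases "v \<in> F")
      case True
      have "?M \<subseteq> out_neighbors D v - S F v"
      proof
        fix w
        assume w: "w \<in> ?M"
        \<comment> \<open>If \<open>w\<close> is unmoved, \<open>a w = b v\<close>, which is not \<open>a v\<close>. If \<open>w\<close> has moved, \<open>b w = b v\<close>, so only
          \<open>a w = a v\<close> could put \<open>w\<close> into \<open>S F v\<close>, and this is where the pairs must differ.\<close>
        then have "(a v, b v) \<noteq> (a w, b w)"
          using proper by (auto simp: proper_coloring_def out_neighbors_def)
        then show "w \<in> out_neighbors D v - S F v"
          using w True distinct[OF v] by (auto simp: S_def c_def split: if_splits)
      qed
      then have "card ?M \<le> card (out_neighbors D v - S F v)"
        by (intro card_mono) (simp_all add: finite_out_neighbors)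
      also have "\<dots> = card (out_neighbors D v) - card (S F v)"
        using fin_S S_sub by (rule card_Diff_subset)
      finally show ?thesis
        using True F_iff[of v] by linarith
    next
      case False
      then have "?M \<subseteq> S F v"
        by (auto simp: S_def c_def split: if_splits)
      then have "card ?M \<le> card (S F v)"
        by (rule card_mono[OF fin_S])
      then show ?thesis
        using False F_iff[of v] by linarith
    qed
  qed
  moreover have "\<forall>v. c v \<in> {a v, b v}"
    by (simp add: c_def)
  ultimately show ?thesis
    by blast
qed

lemma card_distinct_pairs_3:
  assumes "card T = 3"
  shows "card {(x, y). x \<in> T \<and> y \<in> T \<and> x \<noteq> y} = 6"
proof -
  obtain x y z where T: "T = {x, y, z}" "x \<noteq> y" "x \<noteq> z" "y \<noteq> z"
    using assms by (auto simp: card_3_iff)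
  then have "{(x, y). x \<in> T \<and> y \<in> T \<and> x \<noteq> y} = {(x, y), (x, z), (y, x), (y, z), (z, x), (z, y)}"
    by auto
  then show ?thesis
    using T by simp
qed

lemma choosable_imp_majority_choosable:
  fixes D :: "('a, 'b) pre_digraph"
  assumes "digraph D" and choosable: "choosable TYPE('c \<times> 'c) 6 (underlying_graph D)"
  shows "majority_choosable TYPE('c) 3 D"
  unfolding majority_choosable_def
proof (intro allI impI)
  fix L :: "'a \<Rightarrow> 'c set"
  assume L: "list_assignment 3 D L"
  interpret digraph D by fact
  define P where "P v = {(x, y). x \<in> L v \<and> y \<in> L v \<and> x \<noteq> y}" for v
  have "list_assignment 6 (underlying_graph D) P"
    unfolding list_assignment_def
  proof
    fix v
    assume "v \<in> verts (underlying_graph D)"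
    then have "infinite (L v) \<or> 3 \<le> card (L v)"
      using L by (simp add: list_assignment_def)
    then obtain T where T: "T \<subseteq> L v" "finite T" "card T = 3"
      by (rule ex_finite_subset_card)
    have "{(x, y). x \<in> T \<and> y \<in> T \<and> x \<noteq> y} \<subseteq> P v"
      using T by (auto simp: P_def)
    from card_mono[OF _ this] show "infinite (P v) \<or> 6 \<le> card (P v)"
      by (auto simp: card_distinct_pairs_3[OF T(3)])
  qed
  then obtain p where p: "list_coloring (underlying_graph D) P p"
      "proper_coloring (underlying_graph D) p"
    using choosable unfolding choosable_def by blast
  have p_in: "fst (p v) \<in> L v \<and> snd (p v) \<in> L v \<and> fst (p v) \<noteq> snd (p v)" if "v \<in> verts D" for v
    using p(1) that by (auto simp: list_coloring_def P_def case_prod_beta)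
  have "proper_coloring D (\<lambda>v. (fst (p v), snd (p v)))"
    using p(2) by (simp add: proper_coloring_def underlying_graph_adj)
  then obtain c where "majority_coloring D c" "\<forall>v. c v \<in> {fst (p v), snd (p v)}"
    using majority_coloring_from_pairs[of D "\<lambda>v. fst (p v)" "\<lambda>v. snd (p v)"] p_in
      fin_digraph_axioms by blast
  then show "\<exists>c. list_coloring D L c \<and> majority_coloring D c"
    using p_in by (metis list_coloring_def insertE singletonD)
qed

text \<open>
  The vertices of a finite graph use only finitely many colors once their lists are cut down to
  size \<open>k\<close>, and finitely many colors can be renamed injectively to natural numbers.
\<close>

lemma choosable_any_colors:
  assumes "fin_digraph G" and choosable: "choosable TYPE(nat) k G"
  shows "choosable TYPE('c) k G"
  unfolding choosable_def
proof (intro allI impI)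
  fix L :: "_ \<Rightarrow> 'c set"
  assume "list_assignment k G L"
  interpret fin_digraph G by fact
  have "\<exists>T. T \<subseteq> L v \<and> finite T \<and> card T = k" if "v \<in> verts G" for v
    using \<open>list_assignment k G L\<close> that ex_finite_subset_card[of "L v" k]
    by (metis list_assignment_def)
  then obtain T where T: "\<And>v. v \<in> verts G \<Longrightarrow> T v \<subseteq> L v \<and> finite (T v) \<and> card (T v) = k"
    by metis
  have fin_T: "finite (\<Union>v\<in>verts G. T v)"
    using T by simp
  obtain f :: "'c \<Rightarrow> nat" where f: "inj_on f (\<Union>v\<in>verts G. T v)"
    using finite_imp_inj_to_nat_seg[OF fin_T] by blast
  have "card (f ` T v) = k" if "v \<in> verts G" for v
  proof -
    have "inj_on f (T v)"
      using f that by (rule inj_on_subset[OF _ UN_upper])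
    then show ?thesis
      using T[OF that] by (simp add: card_image)
  qed
  then have "list_assignment k G (\<lambda>v. f ` T v)"
    by (simp add: list_assignment_def)
  then obtain c' where c': "list_coloring G (\<lambda>v. f ` T v) c'" "proper_coloring G c'"
    using choosable unfolding choosable_def by blast
  then have "\<forall>v\<in>verts G. \<exists>x\<in>T v. c' v = f x"
    by (auto simp: list_coloring_def)
  then obtain c where c: "\<And>v. v \<in> verts G \<Longrightarrow> c v \<in> T v \<and> c' v = f (c v)"
    by metis
  have "list_coloring G L c"
    using c T by (auto simp: list_coloring_def)
  moreover have "proper_coloring G c"
    using c c'(2) by (metis proper_coloring_def adj_in_verts)
  ultimately show "\<exists>c. list_coloring G L c \<and> proper_coloring G c"
    by blast
qed

lemma (in graph) graph_induce_subgraph: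
  assumes "S \<subseteq> verts G"
  shows "graph (G \<restriction> S)"
proof -
  have induced: "induced_subgraph (G \<restriction> S) G"
    using assms by (rule induced_induce)
  interpret H: digraph "G \<restriction> S"
    using induced by (rule digraphI_induced)
  have "symmetric (G \<restriction> S)"
    using sym_arcs induced by (rule induced_graph_imp_symmetric)
  then show ?thesis
    by unfold_locales
qed

text \<open>
  Greedy coloring: in every nonempty induced subgraph, some vertex has at most \<open>d\<close> neighbors, so if
  it is colored after the others, its neighbors block at most \<open>d\<close> of its \<open>d + 1\<close> colors.
\<close>

lemma degenerate_choosable:
  assumes "graph G" and deg: "degenerate d G"
  shows "choosable TYPE('c) (Suc d) G"
  unfolding choosable_def
proof (intro allI impI)
  fix L :: "_ \<Rightarrow> 'c set"
  assume L: "list_assignment (Suc d) G L"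
  interpret graph G by fact
  have "\<exists>c. \<forall>u\<in>S. c u \<in> L u \<and> (\<forall>v\<in>S. u \<rightarrow>\<^bsub>G\<^esub> v \<longrightarrow> c u \<noteq> c v)" if "S \<subseteq> verts G" for S
  proof -
    have "finite S"
      using that finite_verts by (rule finite_subset)
    then show ?thesis
      using that
    proof (induction S rule: finite_psubset_induct)
      case (psubset S)
      show ?case
      proof (cases "S = {}")
        case False
        interpret H: graph "G \<restriction> S"
          using psubset.prems by (rule graph_induce_subgraph)
        have "subgraph (G \<restriction> S) G"
          using psubset.prems by (intro induced_imp_subgraph induced_induce)
        moreover have "verts (G \<restriction> S) \<noteq> {}"
          using False by simp
        ultimately have "\<exists>v \<in> verts (G \<restriction> S). out_degree (G \<restriction> S) v \<le> d"
          using deg H.graph_axioms unfolding degenerate_def by blast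
        then obtain v where v: "v \<in> S" and deg_v: "out_degree (G \<restriction> S) v \<le> d"
          by auto
        obtain c where c: "\<forall>u\<in>S - {v}. c u \<in> L u \<and> (\<forall>w\<in>S - {v}. u \<rightarrow>\<^bsub>G\<^esub> w \<longrightarrow> c u \<noteq> c w)"
          using psubset.IH[of "S - {v}"] psubset.prems v by blast
        let ?N = "{w \<in> S. v \<rightarrow>\<^bsub>G\<^esub> w}"
        have "?N \<subseteq> head G ` out_arcs (G \<restriction> S) v"
          using v by (force simp: arcs_ends_conv out_arcs_def)
        then have "card ?N \<le> out_degree (G \<restriction> S) v"
          unfolding out_degree_def by (rule surj_card_le[OF H.finite_out_arcs])
        moreover have fin_N: "finite ?N"
          using psubset.hyps by simp
        ultimately have "card (c ` ?N) \<le> d"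
          using deg_v card_image_le[of ?N c] by linarith
        moreover have "infinite (L v) \<or> Suc d \<le> card (L v)"
          using L v psubset.prems by (auto simp: list_assignment_def)
        ultimately have "\<not> L v \<subseteq> c ` ?N"
          using card_mono[of "c ` ?N" "L v"] finite_subset[of "L v" "c ` ?N"]
            finite_imageI[OF fin_N, of c] by linarith
        then obtain x where x: "x \<in> L v" "x \<notin> c ` ?N"
          by blast
        have "v \<rightarrow>\<^bsub>G\<^esub> w" if "w \<rightarrow>\<^bsub>G\<^esub> v" for w
          using that by (rule graph_symmetric)
        moreover have "\<not> v \<rightarrow>\<^bsub>G\<^esub> v"
          using adj_not_same by blast
        ultimately have "\<forall>u\<in>S. (c(v := x)) u \<in> L u \<and>
            (\<forall>w\<in>S. u \<rightarrow>\<^bsub>G\<^esub> w \<longrightarrow> (c(v := x)) u \<noteq> (c(v := x)) w)"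
          using c x v by auto
        then show ?thesis
          by blast
      qed simp
    qed
  qed
  from this[of "verts G"] show "\<exists>c. list_coloring G L c \<and> proper_coloring G c"
    unfolding list_coloring_def proper_coloring_def by (metis adj_in_verts subset_refl)
qed

theorem theorem4:
  fixes D :: "('a, 'b) pre_digraph"
  assumes "digraph D"
  shows "(choosable TYPE(nat) 6 (underlying_graph D) \<longrightarrow> majority_choosable TYPE('c) 3 D) \<and>
    (degenerate 5 (underlying_graph D) \<longrightarrow> majority_choosable TYPE('c) 3 D)"
proof -
  interpret U: graph "underlying_graph D"
    using assms by (rule graph_underlying_graph)
  have "choosable TYPE('c \<times> 'c) 6 (underlying_graph D)"
    if "choosable TYPE(nat) 6 (underlying_graph D)"
    using U.fin_digraph_axioms that by (rule choosable_any_colors)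
  moreover have "choosable TYPE('c \<times> 'c) 6 (underlying_graph D)"
    if "degenerate 5 (underlying_graph D)"
    using degenerate_choosable[OF U.graph_axioms that] by simp
  ultimately show ?thesis
    using choosable_imp_majority_choosable[OF assms] by blast
qed

end
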